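(* Fix a state $s$ and let $v^*(x,t;s)$ be the pointwise minimizer of the conditional flow matching loss $$\mathcal{L}_{\mathrm{FM}}=\mathbb{E}_{t\sim\mathcal{U}[0,1],\,z\sim\mathcal{N}(0,I_d),\,a\sim p(\cdot\mid s)}\left[\|v(x_t,t;s)-(a-z)\|^2\right],\qquad x_t=t\,a+(1-t)\,z .$$ Then for every query point $x\in\mathbb{R}^d$ and every time $t\in(0,1)$, $$x+(1-t)\,v^*(x,t;s)=\mathbb{E}[a\mid x_t=x,\,t,\,s],$$ regardless of how $x$ was constructed. In particular, for every $k\ge 1$ with $t_k\in(0,1)$, the VINE endpoint prediction $$\hat a_k=\hat x_k+(1-t_k)\,v^*(\hat x_k,t_k;s),\qquad \hat x_k=t_k\,\hat a_{k-1}+(1-t_k)\,z_k,$$ satisfies $$\hat a_k=\mathbb{E}[a\mid x_{t_k}=\hat x_k,\,t_k,\,s],$$ i.e. $\hat a_k$ is the Bayes-optimal estimate of the action (under squared error) given the noisy intermediate $\hat x_k$, even though $\hat x_k$ was not generated by the flow matching ODE.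
   Context: Let $d\ge 1$. For a fixed state $s$, $p(\cdot\mid s)$ is a probability distribution on the action space $\mathbb{R}^d$. In flow matching training, $a\sim p(\cdot\mid s)$, $z\sim\mathcal{N}(0,I_d)$ and $t\sim\mathcal{U}[0,1]$ are drawn independently, and $x_t=t\,a+(1-t)\,z$. For $t\in(0,1)$ the noise $(1-t)z$ has an everywhere positive Gaussian density, so the conditional law of $(a,z)$ given $x_t=x$ is defined for every $x\in\mathbb{R}^d$: $a$ has the law with density proportional to $\exp\!\big(-\|x-ta\|^2/(2(1-t)^2)\big)$ with respect to $p(da\mid s)$, and $z=(x-ta)/(1-t)$. The notation $\mathbb{E}[\,\cdot\mid x_t=x,t,s]$ denotes expectation under this law. "Pointwise minimizer of $\mathcal{L}_{\mathrm{FM}}$" means: for each $x\in\mathbb{R}^d$ and $t\in(0,1)$, $v^*(x,t;s)$ is the vector $v\in\mathbb{R}^d$ minimizing $\mathbb{E}\left[\|v-(a-z)\|^2\mid x_t=x,t,s\right]$. The flow matching ODE is $\mathrm{d}\hat X_t=v(\hat X_t,t;s)\,\mathrm{d}t$, $\hat X_0\sim\mathcal{N}(0,I_d)$. The VINE sampler does not follow this ODE: given times $t_k$, a current action estimate $\hat a_{k-1}\in\mathbb{R}^d$ and a fresh noise vector $z_k\in\mathbb{R}^d$ (drawn from $\mathcal{N}(0,I_d)$ independently at each step), it forms the intermediate $\hat x_k=t_k\hat a_{k-1}+(1-t_k)z_k$ and then the endpoint prediction $\hat a_k=\hat x_k+(1-t_k)\,v(\hat x_k,t_k;s)$; here $v=v^*$.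 "Bayes-optimal estimate under squared error given $x$ at time $t$" means the minimizer over $b\in\mathbb{R}^d$ of $\mathbb{E}[\|a-b\|^2\mid x_t=x,t,s]$. *)

theory Defs
  imports "HOL-Probability.Probability"
begin

text \<open>
  Throughout, \<open>p s\<close> is the distribution of the action \<open>a\<close> in state \<open>s\<close>, \<open>z\<close> is standard Gaussian noise
  independent of \<open>a\<close>, and \<open>x\<^sub>t = t a + (1 - t) z\<close> with \<open>0 < t < 1\<close>.
\<close>

text \<open>
  The conditional density of \<open>x\<^sub>t\<close> at \<open>x\<close> given \<open>a\<close>, up to the factor \<open>(2 \<pi> (1 - t)\<^sup>2) powr (-d / 2)\<close>,
  which does not depend on \<open>a\<close>.
\<close>

definition fm_weight :: "real ^ 'n \<Rightarrow> real \<Rightarrow> real ^ 'n \<Rightarrow> real" where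
  "fm_weight x t a = exp (- (norm (x - t *\<^sub>R a))\<^sup>2 / (2 * (1 - t)\<^sup>2))"

definition action_posterior ::
    "('s \<Rightarrow> (real ^ 'n) measure) \<Rightarrow> 's \<Rightarrow> real ^ 'n \<Rightarrow> real \<Rightarrow> (real ^ 'n) measure" where
  "action_posterior p s x t =
     density (p s) (\<lambda>a. ennreal (fm_weight x t a / (\<integral>b. fm_weight x t b \<partial>p s)))"

text \<open>
  The conditional law of the pair \<open>(a, z)\<close> given \<open>x\<^sub>t = x\<close>. It is defined for every \<open>x\<close>, not only for
  almost every \<open>x\<close>.
\<close>

definition fm_cond_law ::
    "('s \<Rightarrow> (real ^ 'n) measure) \<Rightarrow> 's \<Rightarrow> real ^ 'n \<Rightarrow> real \<Rightarrow> ((real ^ 'n) \<times> (real ^ 'n)) measure" where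
  "fm_cond_law p s x t =
     distr (action_posterior p s x t) (borel \<Otimes>\<^sub>M borel) (\<lambda>a. (a, (1 / (1 - t)) *\<^sub>R (x - t *\<^sub>R a)))"

definition fm_cond_expectation ::
    "('s \<Rightarrow> (real ^ 'n) measure) \<Rightarrow> 's \<Rightarrow> real ^ 'n \<Rightarrow> real \<Rightarrow>
     (real ^ 'n \<Rightarrow> real ^ 'n \<Rightarrow> 'b :: {banach, second_countable_topology}) \<Rightarrow> 'b" where
  "fm_cond_expectation p s x t f = (\<integral>(a, z). f a z \<partial>fm_cond_law p s x t)"

definition fm_pointwise_loss ::
    "('s \<Rightarrow> (real ^ 'n) measure) \<Rightarrow> 's \<Rightarrow> real ^ 'n \<Rightarrow> real \<Rightarrow> real ^ 'n \<Rightarrow> real" where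
  "fm_pointwise_loss p s x t u = fm_cond_expectation p s x t (\<lambda>a z. (norm (u - (a - z)))\<^sup>2)"

definition fm_pointwise_minimizer ::
    "('s \<Rightarrow> (real ^ 'n) measure) \<Rightarrow> 's \<Rightarrow> real ^ 'n \<Rightarrow> real \<Rightarrow> real ^ 'n" where
  "fm_pointwise_minimizer p s x t =
     (THE u. is_arg_min (fm_pointwise_loss p s x t) (\<lambda>_. True) u)"

definition bayes_risk ::
    "('s \<Rightarrow> (real ^ 'n) measure) \<Rightarrow> 's \<Rightarrow> real ^ 'n \<Rightarrow> real \<Rightarrow> real ^ 'n \<Rightarrow> real" where
  "bayes_risk p s x t b = fm_cond_expectation p s x t (\<lambda>a z. (norm (a - b))\<^sup>2)"

text \<open>\<open>b\<close> is the unique minimizer of the Bayes risk.\<close>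

definition is_bayes_optimal_estimate ::
    "('s \<Rightarrow> (real ^ 'n) measure) \<Rightarrow> 's \<Rightarrow> real ^ 'n \<Rightarrow> real \<Rightarrow> real ^ 'n \<Rightarrow> bool" where
  "is_bayes_optimal_estimate p s x t b \<longleftrightarrow>
     (\<forall>c. is_arg_min (bayes_risk p s x t) (\<lambda>_. True) c \<longleftrightarrow> c = b)"

text \<open>
  A run of the VINE sampler with velocity field \<open>v\<close> in state \<open>s\<close>, for a schedule \<open>t\<close>, a realization \<open>z\<close> of
  the noise, intermediates \<open>xh\<close> and action estimates \<open>ah\<close>; the initial estimate is \<open>ah 0\<close>. The values
  \<open>t 0\<close>, \<open>z 0\<close> and \<open>xh 0\<close> are not used.
\<close>

definition vine_run ::
    "(real ^ 'n \<Rightarrow> real \<Rightarrow> 's \<Rightarrow> real ^ 'n) \<Rightarrow> 's \<Rightarrow> (nat \<Rightarrow> real) \<Rightarrow> (nat \<Rightarrow> real ^ 'n) \<Rightarrow>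
     (nat \<Rightarrow> real ^ 'n) \<Rightarrow> (nat \<Rightarrow> real ^ 'n) \<Rightarrow> bool" where
  "vine_run v s t z xh ah \<longleftrightarrow>
     (\<forall>k\<ge>1. xh k = t k *\<^sub>R ah (k - 1) + (1 - t k) *\<^sub>R z k \<and>
            ah k = xh k + (1 - t k) *\<^sub>R v (xh k) (t k) s)"

end

(* Given x, the noise is a function of the action, and
     u - (a - z) = ((x + (1 - t) u) - a) / (1 - t),
   so the pointwise flow matching loss at u is (1 - t)^(-2) times the Bayes risk at x + (1 - t) u.
   The Gaussian weight gives the posterior a finite second moment whatever p is, so the Bayes risk
   is uniquely minimized at the posterior mean. *)
theory Submission
  imports Defs
begin

lemma mult_exp_minus_le_one: "(y::real) * exp (- y) \<le> 1"
proof -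
  have "y \<le> exp y"
    using exp_ge_add_one_self[of y] by linarith
  then show ?thesis
    by (simp add: exp_minus divide_simps)
qed

lemma fm_weight_measurable [measurable]: "fm_weight x t \<in> borel_measurable borel"
  unfolding fm_weight_def by measurable

lemma fm_weight_pos: "fm_weight x t a > 0"
  by (simp add: fm_weight_def)

lemma fm_weight_le_one: "fm_weight x t a \<le> 1"
  by (simp add: fm_weight_def)

text \<open>Writing \<open>t a = x - (x - t a)\<close> bounds \<open>norm a\<close> by the residual
  \<open>x - t a\<close>, and the Gaussian factor decays in that residual faster than its square
  grows. The bound is uniform in \<open>a\<close>, so it yields a posterior second moment without
  any moment assumption on \<open>p s\<close>.\<close>

lemma norm_square_fm_weight_le:
  fixes x a :: "real ^ 'n"
  assumes "0 < t" "t < 1"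
  shows "(norm a)\<^sup>2 * fm_weight x t a \<le> (2 * (norm x)\<^sup>2 + 4 * (1 - t)\<^sup>2) / t\<^sup>2"
proof -
  define r where "r = norm (x - t *\<^sub>R a)"
  define w where "w = fm_weight x t a"
  have w: "0 < w" "w \<le> 1"
    using fm_weight_pos fm_weight_le_one by (auto simp: w_def)
  have "t * norm a = norm (x - (x - t *\<^sub>R a))"
    using assms by simp
  also have "\<dots> \<le> norm x + r"
    unfolding r_def by (rule norm_triangle_ineq4)
  finally have "(t * norm a)\<^sup>2 \<le> (norm x + r)\<^sup>2"
    using assms by (intro power_mono) auto
  also have "\<dots> \<le> 2 * (norm x)\<^sup>2 + 2 * r\<^sup>2"
    using sum_squares_bound[of "norm x" r] by (simp add: power2_sum)
  finally have "(t * norm a)\<^sup>2 * w \<le> (2 * (norm x)\<^sup>2 + 2 * r\<^sup>2) * w"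
    using w by (intro mult_right_mono) auto
  moreover have "(norm x)\<^sup>2 * w \<le> (norm x)\<^sup>2"
    using w by (simp add: mult_left_le)
  moreover have "r\<^sup>2 * w \<le> 2 * (1 - t)\<^sup>2"
  proof -
    \<comment> \<open>\<open>y\<close> is the negated Gaussian exponent, so
      \<open>w = exp (- y)\<close>; the constant \<open>2 * (1 - t)\<^sup>2\<close> is what remains
      after \<open>y * exp (- y) \<le> 1\<close>.\<close>
    define y where "y = r\<^sup>2 / (2 * (1 - t)\<^sup>2)"
    have "r\<^sup>2 * w = 2 * (1 - t)\<^sup>2 * (y * exp (- y))"
      using assms by (simp add: w_def fm_weight_def y_def r_def)
    also have "\<dots> \<le> 2 * (1 - t)\<^sup>2"
      using mult_exp_minus_le_one[of y] by (intro mult_left_le) auto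
    finally show ?thesis .
  qed
  ultimately have "(t * norm a)\<^sup>2 * w \<le> 2 * (norm x)\<^sup>2 + 4 * (1 - t)\<^sup>2"
    by (simp add: algebra_simps)
  then show ?thesis
    using assms by (simp add: w_def field_simps)
qed

text \<open>Bias-variance decomposition: expanding the square turns the mean squared error into a
  quadratic in the guess, whose linear term involves only the mean of \<open>X\<close>.\<close>

lemma (in prob_space) expectation_norm_diff_square:
  fixes X :: "'a \<Rightarrow> 'b::euclidean_space"
  assumes [measurable]: "random_variable borel X"
    and sq: "integrable M (\<lambda>\<omega>. (norm (X \<omega>))\<^sup>2)"
  shows "expectation (\<lambda>\<omega>. (norm (X \<omega> - b))\<^sup>2) =
    expectation (\<lambda>\<omega>. (norm (X \<omega> - expectation X))\<^sup>2) + (norm (b - expectation X))\<^sup>2"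
proof -
  \<comment> \<open>Total mass is finite, so \<open>1 + (norm X)\<^sup>2\<close> is integrable and
    dominates \<open>norm X\<close>.\<close>
  have X: "integrable M X"
  proof (rule Bochner_Integration.integrable_bound)
    show "integrable M (\<lambda>\<omega>. 1 + (norm (X \<omega>))\<^sup>2)"
      using sq by simp
    have "norm (X \<omega>) \<le> 1 + (norm (X \<omega>))\<^sup>2" for \<omega>
      using sum_squares_bound[of "norm (X \<omega>)" 1] norm_ge_zero[of "X \<omega>"]
      unfolding one_power2 mult_1_right by linarith
    then show "AE \<omega> in M. norm (X \<omega>) \<le> norm (1 + (norm (X \<omega>))\<^sup>2)"
      by (auto intro: order_trans)
  qed simp
  have expand: "(norm (y - c))\<^sup>2 = (norm y)\<^sup>2 - 2 * (y \<bullet> c) + (norm c)\<^sup>2" for y c :: 'b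
    by (simp add: power2_norm_eq_inner inner_diff inner_commute algebra_simps)
  have "expectation (\<lambda>\<omega>. (norm (X \<omega> - c))\<^sup>2) =
      expectation (\<lambda>\<omega>. (norm (X \<omega>))\<^sup>2) - 2 * (expectation X \<bullet> c) + (norm c)\<^sup>2" for c
    using X sq by (simp add: expand prob_space)
  \<comment> \<open>Compare the formula at \<open>c = b\<close> with the one at
    \<open>c = expectation X\<close>.\<close>
  then show ?thesis
    by (simp add: expand[of b "expectation X"] inner_commute flip: power2_norm_eq_inner)
qed

lemma action_posterior_prob_space_square_integrable:
  fixes x :: "real ^ 'n"
  assumes "prob_space (p s)" and sets [measurable_cong]: "sets (p s) = sets borel"
    and t: "0 < t" "t < 1"
  shows "prob_space (action_posterior p s x t)"
    and "integrable (action_posterior p s x t) (\<lambda>a. (norm a)\<^sup>2)"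
proof -
  interpret prob_space "p s" by fact
  let ?w = "fm_weight x t"
  define Z where "Z = (\<integral>b. ?w b \<partial>p s)"
  have w: "integrable (p s) ?w"
    using fm_weight_pos[of x t] fm_weight_le_one[of x t]
    by (intro integrable_const_bound[where B = 1]) (auto simp: less_imp_le)
  \<comment> \<open>A nonnegative function with integral zero vanishes almost everywhere, hence at
    some point of a probability space; the Gaussian weight vanishes nowhere.\<close>
  have "Z \<noteq> 0"
    using integral_nonneg_eq_0_iff_AE[OF w] fm_weight_pos[of x t]
    by (auto simp: Z_def less_imp_le dest!: AE_E_prob simp: order_less_imp_not_eq2)
  moreover have "Z \<ge> 0"
    unfolding Z_def by (intro Bochner_Integration.integral_nonneg) (simp add: fm_weight_pos less_imp_le)
  ultimately have Z: "Z > 0" by simp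
  have nonneg: "0 \<le> ?w a / Z" for a
    using Z fm_weight_pos[of x t a] by simp
  have "emeasure (action_posterior p s x t) (space (p s)) = (\<integral>\<^sup>+a. ennreal (?w a / Z) \<partial>p s)"
    by (simp add: action_posterior_def emeasure_density Z_def)
  also have "\<dots> = ennreal (\<integral>a. ?w a / Z \<partial>p s)"
    using w nonneg by (intro nn_integral_eq_integral) auto
  also have "(\<integral>a. ?w a / Z \<partial>p s) = 1"
    using Z by (simp add: Z_def)
  finally show "prob_space (action_posterior p s x t)"
    by (intro prob_spaceI) (simp add: action_posterior_def)
  have "integrable (p s) (\<lambda>a. (norm a)\<^sup>2 * ?w a)"
    using norm_square_fm_weight_le[OF t, of _ x] fm_weight_pos[of x t]
    by (intro integrable_const_bound[where B = "(2 * (norm x)\<^sup>2 + 4 * (1 - t)\<^sup>2) / t\<^sup>2"])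
       (auto simp: abs_mult less_imp_le)
  then have "integrable (p s) (\<lambda>a. (?w a / Z) *\<^sub>R (norm a)\<^sup>2)"
    by (auto simp: mult.commute)
  then show "integrable (action_posterior p s x t) (\<lambda>a. (norm a)\<^sup>2)"
    using nonneg by (simp add: action_posterior_def Z_def[symmetric] integrable_density)
qed

lemma sets_action_posterior [simp, measurable_cong]:
  "sets (action_posterior p s x t) = sets (p s)"
  by (simp add: action_posterior_def)

text \<open>Change of variables along the map from \<open>a\<close> to \<open>(a, z)\<close>: given
  \<open>x\<close>, the action alone carries the randomness.\<close>

lemma fm_cond_expectation_eq_posterior:
  assumes [measurable_cong]: "sets (p s) = sets borel"
    and [measurable]: "(\<lambda>(a, z). f a z) \<in> borel_measurable (borel \<Otimes>\<^sub>M borel)"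
  shows "fm_cond_expectation p s x t f =
    (\<integral>a. f a ((1 / (1 - t)) *\<^sub>R (x - t *\<^sub>R a)) \<partial>action_posterior p s x t)"
  unfolding fm_cond_expectation_def fm_cond_law_def by (subst integral_distr) auto

lemma fm_pointwise_loss_eq_bayes_risk:
  fixes x :: "real ^ 'n"
  assumes sets: "sets (p s) = sets borel" and t: "t < 1"
  shows "fm_pointwise_loss p s x t u = bayes_risk p s x t (x + (1 - t) *\<^sub>R u) / (1 - t)\<^sup>2"
proof -
  have "(norm (u - (a - (1 / (1 - t)) *\<^sub>R (x - t *\<^sub>R a))))\<^sup>2 =
      (norm (a - (x + (1 - t) *\<^sub>R u)))\<^sup>2 / (1 - t)\<^sup>2" for a
  proof -
    \<comment> \<open>Scaling by \<open>1 - t\<close> clears the denominator of the noise; the terms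
      in \<open>t *\<^sub>R a\<close> then cancel.\<close>
    have "(1 - t) *\<^sub>R (u - (a - (1 / (1 - t)) *\<^sub>R (x - t *\<^sub>R a))) =
        (1 - t) *\<^sub>R u - (1 - t) *\<^sub>R a + (x - t *\<^sub>R a)"
      using t by (simp add: scaleR_right_diff_distrib)
    also have "\<dots> = - (a - (x + (1 - t) *\<^sub>R u))"
      by (simp add: algebra_simps)
    finally have "norm ((1 - t) *\<^sub>R (u - (a - (1 / (1 - t)) *\<^sub>R (x - t *\<^sub>R a)))) =
        norm (a - (x + (1 - t) *\<^sub>R u))"
      by (simp only: norm_minus_cancel)
    then have "(1 - t) * norm (u - (a - (1 / (1 - t)) *\<^sub>R (x - t *\<^sub>R a))) =
        norm (a - (x + (1 - t) *\<^sub>R u))"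
      using t by simp
    then show ?thesis
      using t by (simp flip: power_divide) (simp add: field_simps)
  qed
  then show ?thesis
    unfolding fm_pointwise_loss_def bayes_risk_def
    by (simp add: fm_cond_expectation_eq_posterior[where p = p and s = s, OF sets])
qed

text \<open>The bias-variance decomposition of the identity variable under the posterior, whose mean
  is \<open>m\<close>.\<close>

lemma bayes_risk_eq:
  fixes x :: "real ^ 'n"
  assumes "prob_space (p s)" and sets: "sets (p s) = sets borel" and t: "0 < t" "t < 1"
  defines "m \<equiv> fm_cond_expectation p s x t (\<lambda>a z. a)"
  shows "bayes_risk p s x t b = bayes_risk p s x t m + (norm (b - m))\<^sup>2"
proof -
  note [measurable_cong] = sets
  interpret prob_space "action_posterior p s x t"
    using assms by (intro action_posterior_prob_space_square_integrable)
  have "(\<lambda>a. a) \<in> borel_measurable (action_posterior p s x t)"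
    by measurable
  then show ?thesis
    using expectation_norm_diff_square[of "\<lambda>a. a" b]
      action_posterior_prob_space_square_integrable(2)[where p = p and s = s, OF assms(1-4), of x]
    by (simp add: m_def bayes_risk_def fm_cond_expectation_eq_posterior[where p = p and s = s, OF sets])
qed

text \<open>The excess over \<open>f m\<close> is a squared distance, which is zero only at
  \<open>m\<close>. This gives existence and uniqueness together, for both the flow matching loss
  and the Bayes risk.\<close>

lemma is_arg_min_add_norm_square_iff:
  assumes "\<And>b. f b = f m + (norm (b - m :: 'a::real_normed_vector))\<^sup>2"
  shows "is_arg_min f (\<lambda>_. True) c \<longleftrightarrow> c = m"
proof -
  have "f m < f c" if "c \<noteq> m" for c
    using that assms[of c] by simp
  moreover have "f m \<le> f c" for c
    using assms[of c] by simp
  ultimately show ?thesis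
    unfolding is_arg_min_def by (metis not_less)
qed

lemma fm_pointwise_minimizer_endpoint:
  fixes x :: "real ^ 'n"
  assumes "prob_space (p s)" "sets (p s) = sets borel" and t: "0 < t" "t < 1"
  shows "x + (1 - t) *\<^sub>R fm_pointwise_minimizer p s x t = fm_cond_expectation p s x t (\<lambda>a z. a)"
proof -
  define m where "m = fm_cond_expectation p s x t (\<lambda>a z. a)"
  \<comment> \<open>The velocity whose endpoint is the posterior mean, obtained by solving
    \<open>x + (1 - t) u = m\<close>.\<close>
  define u where "u = (1 / (1 - t)) *\<^sub>R (m - x)"
  have u: "x + (1 - t) *\<^sub>R u = m"
    using t by (simp add: u_def)
  \<comment> \<open>The factor \<open>1 / (1 - t)\<^sup>2\<close> between loss and risk cancels the
    scaling of \<open>w - u\<close> by \<open>1 - t\<close> exactly.\<close>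
  have "fm_pointwise_loss p s x t w = fm_pointwise_loss p s x t u + (norm (w - u))\<^sup>2" for w
  proof -
    have "norm (x + (1 - t) *\<^sub>R w - m) = norm ((1 - t) *\<^sub>R (w - u))"
      by (simp add: scaleR_right_diff_distrib flip: u)
    then have "(norm (x + (1 - t) *\<^sub>R w - m))\<^sup>2 / (1 - t)\<^sup>2 = (norm (w - u))\<^sup>2"
      using t by (simp add: power_mult_distrib)
    then show ?thesis
      using t bayes_risk_eq[where p = p and s = s and x = x and b = "x + (1 - t) *\<^sub>R w", OF assms]
      by (simp add: fm_pointwise_loss_eq_bayes_risk[where p = p and s = s, OF assms(2)] u add_divide_distrib flip: m_def)
  qed
  then have "is_arg_min (fm_pointwise_loss p s x t) (\<lambda>_. True) w \<longleftrightarrow> w = u" for w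
    by (rule is_arg_min_add_norm_square_iff)
  \<comment> \<open>Uniqueness of the minimizer lets the \<open>THE\<close> in
    \<open>fm_pointwise_minimizer\<close> evaluate to \<open>u\<close>.\<close>
  then show ?thesis
    by (simp add: fm_pointwise_minimizer_def u m_def)
qed

lemma is_bayes_optimal_estimate_cond_expectation:
  fixes x :: "real ^ 'n"
  assumes "prob_space (p s)" "sets (p s) = sets borel" "0 < t" "t < 1"
  shows "is_bayes_optimal_estimate p s x t (fm_cond_expectation p s x t (\<lambda>a z. a))"
  unfolding is_bayes_optimal_estimate_def
  using is_arg_min_add_norm_square_iff[OF bayes_risk_eq[where p = p and s = s, OF assms]] by blast

theorem theorem1:
  fixes p :: "'s \<Rightarrow> (real ^ 'n) measure"
    and s :: 's
    and v :: "real ^ 'n \<Rightarrow> real \<Rightarrow> 's \<Rightarrow> real ^ 'n"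
  assumes "prob_space (p s)"
    and "sets (p s) = sets borel"
    and "\<And>x t. t \<in> {0<..<1} \<Longrightarrow> v x t s = fm_pointwise_minimizer p s x t"
  shows "(\<forall>x. \<forall>t\<in>{0<..<1}. x + (1 - t) *\<^sub>R v x t s = fm_cond_expectation p s x t (\<lambda>a z. a)) \<and>
         (\<forall>t z xh ah. vine_run v s t z xh ah \<longrightarrow>
           (\<forall>k\<ge>1. t k \<in> {0<..<1} \<longrightarrow>
             ah k = fm_cond_expectation p s (xh k) (t k) (\<lambda>a z. a) \<and>
             is_bayes_optimal_estimate p s (xh k) (t k) (ah k)))"
proof -
  have endpoint: "x + (1 - t) *\<^sub>R v x t s = fm_cond_expectation p s x t (\<lambda>a z. a)"
    if "t \<in> {0<..<1}" for x t
    using that assms(3)[OF that] fm_pointwise_minimizer_endpoint[where p = p and s = s, OF assms(1,2)] by simp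
  have step: "ah k = fm_cond_expectation p s (xh k) (t k) (\<lambda>a z. a) \<and>
      is_bayes_optimal_estimate p s (xh k) (t k) (ah k)"
    if run: "vine_run v s t z xh ah" "k \<ge> 1" and t: "t k \<in> {0<..<1}" for t z xh ah k
  proof -
    \<comment> \<open>The sampler's update of \<open>ah k\<close> is the endpoint formula at the
      query point \<open>xh k\<close>, and \<open>endpoint\<close> holds at every point of the
      space.\<close>
    have "ah k = fm_cond_expectation p s (xh k) (t k) (\<lambda>a z. a)"
      using run endpoint[OF t] by (simp add: vine_run_def)
    then show ?thesis
      using t is_bayes_optimal_estimate_cond_expectation[where p = p and s = s, OF assms(1,2)] by simp
  qed
  show ?thesis
    by (intro conjI allI ballI impI endpoint) (blast dest: step)+
qed

end
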